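(* Let $K$ be a field, $\varphi$ a ring endomorphism of $K$, and $R=K[t;\varphi]$. Then every complete theory (in the language $L_{Mod}(R)=\{0,+,-\}\cup\{\cdot r: r\in R\}$ of right $R$-modules) of non-zero divisible $R$-modules admits elimination of quantifiers. Moreover, the complete theory of a non-zero divisible $R$-module $M$ is determined by specifying, for each irreducible $q\in R$, the number $|ann_M(q)|\in\mathbb{N}\cup\{\infty\}$ of elements of $M$ annihilated by $q$; i.e. two non-zero divisible $R$-modules $M,N$ are elementarily equivalent if and only if $|ann_M(q)|=|ann_N(q)|$ (as elements of $\mathbb{N}\cup\{\infty\}$) for every irreducible $q\in R$.
   Context: $R=K[t;\varphi]$ is the ring of twisted polynomials: its elements are finite formal sums $\sum_{i\in\mathbb{N}}t^ia_i$ with $a_i\in K$, added termwise and multiplied according to the rule $at=t\varphi(a)$ for $a\in K$ (so $(\sum t^ia_i)(\sum t^jb_j)=\sum_k t^kc_k$ with $c_k=\sum_{i+j=k}\varphi^j(a_i)b_j$). Modules are right $R$-modules, the action written $x.r$. An $R$-module $M$ is divisible if for every $x\in M$ and every non-zero $r\in R$ there is $y\in M$ with $y.r=x$. For $r\in R$, $ann_M(r)=\{x\in M: x.r=0\}$. Irreducible means non-unit (units of $R$ are $K^\times$) not a product of two non-units. *)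

theory Defs
  imports
    "HOL-Computational_Algebra.Polynomial"
    "HOL-Library.Extended_Nat"
begin

section \<open>The twisted polynomial ring\<close>

definition ring_endomorphism :: "('k::field \<Rightarrow> 'k) \<Rightarrow> bool" where
  "ring_endomorphism \<phi> \<longleftrightarrow>
     (\<forall>a b. \<phi> (a + b) = \<phi> a + \<phi> b) \<and> (\<forall>a b. \<phi> (a * b) = \<phi> a * \<phi> b) \<and> \<phi> 1 = 1"

text \<open>
  The ring \<open>K[t;\<phi>]\<close> has the additive group \<open>'k poly\<close>; the polynomial with coefficients
  \<open>a\<^sub>i\<close> stands for the sum of the \<open>t\<^sup>i a\<^sub>i\<close>, with coefficients on the right. Only the
  multiplication depends on \<open>\<phi>\<close>, and the unit element is the polynomial \<open>1\<close>.
\<close>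

definition skew_mult :: "('k::field \<Rightarrow> 'k) \<Rightarrow> 'k poly \<Rightarrow> 'k poly \<Rightarrow> 'k poly" where
  "skew_mult \<phi> p q =
     (\<Sum>i\<le>degree p. \<Sum>j\<le>degree q. monom ((\<phi> ^^ j) (coeff p i) * coeff q j) (i + j))"

lemma ring_endomorphism_zero:
  assumes "ring_endomorphism \<phi>"
  shows "\<phi> 0 = 0"
proof -
  have "\<phi> 0 + \<phi> 0 = \<phi> 0"
    using assms unfolding ring_endomorphism_def by (metis add_0)
  then show ?thesis by (metis add_cancel_left_left)
qed

lemma coeff_skew_mult:
  assumes "ring_endomorphism \<phi>"
  shows "coeff (skew_mult \<phi> p q) k = (\<Sum>i\<le>k. (\<phi> ^^ (k - i)) (coeff p i) * coeff q (k - i))"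
proof -
  have pow0: "(\<phi> ^^ j) 0 = 0" for j
    by (induction j) (simp_all add: ring_endomorphism_zero[OF assms])
  let ?f = "\<lambda>i. (\<phi> ^^ (k - i)) (coeff p i) * coeff q (k - i)"
  have inner: "(\<Sum>j\<le>degree q. coeff (monom ((\<phi> ^^ j) (coeff p i) * coeff q j) (i + j)) k)
      = (if i \<le> k then ?f i else 0)" for i
  proof (cases "i \<le> k")
    case True
    have "(\<Sum>j\<le>degree q. coeff (monom ((\<phi> ^^ j) (coeff p i) * coeff q j) (i + j)) k)
        = (\<Sum>j\<le>degree q. if j = k - i then ?f i else 0)"
      using True by (intro sum.cong) auto
    also have "\<dots> = ?f i"
      by (auto simp: coeff_eq_0)
    finally show ?thesis using True by simp
  qed auto
  have "coeff (skew_mult \<phi> p q) k = (\<Sum>i\<le>degree p. if i \<le> k then ?f i else 0)"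
    unfolding skew_mult_def by (simp only: coeff_sum inner)
  also have "\<dots> = (\<Sum>i\<in>{..degree p} \<inter> {..k}. ?f i)"
    by (simp add: sum.inter_restrict del: Int_atMost)
  also have "\<dots> = (\<Sum>i\<le>k. ?f i)"
    by (rule sum.mono_neutral_left) (auto simp: coeff_eq_0 pow0)
  finally show ?thesis .
qed

definition skew_unit :: "('k::field \<Rightarrow> 'k) \<Rightarrow> 'k poly \<Rightarrow> bool" where
  "skew_unit \<phi> u \<longleftrightarrow> (\<exists>v. skew_mult \<phi> u v = 1 \<and> skew_mult \<phi> v u = 1)"

definition skew_irreducible :: "('k::field \<Rightarrow> 'k) \<Rightarrow> 'k poly \<Rightarrow> bool" where
  "skew_irreducible \<phi> q \<longleftrightarrow>
     \<not> skew_unit \<phi> q \<and>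
     \<not> (\<exists>a b. \<not> skew_unit \<phi> a \<and> \<not> skew_unit \<phi> b \<and> q = skew_mult \<phi> a b)"


section \<open>Right modules\<close>

text \<open>A module is given by the scalar action on the whole additive group of a type.\<close>

locale right_module =
  fixes \<phi> :: "'k::field \<Rightarrow> 'k"
    and act :: "'m::ab_group_add \<Rightarrow> 'k poly \<Rightarrow> 'm"
  assumes act_add_left: "act (x + y) r = act x r + act y r"
    and act_add_right: "act x (r + s) = act x r + act x s"
    and act_mult: "act x (skew_mult \<phi> r s) = act (act x r) s"
    and act_one: "act x 1 = x"

definition divisible_module :: "('m::ab_group_add \<Rightarrow> 'r::zero \<Rightarrow> 'm) \<Rightarrow> bool" where
  "divisible_module act \<longleftrightarrow> (\<forall>x r. r \<noteq> 0 \<longrightarrow> (\<exists>y. act y r = x))"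

definition nonzero_divisible_module ::
    "('k::field \<Rightarrow> 'k) \<Rightarrow> ('m::ab_group_add \<Rightarrow> 'k poly \<Rightarrow> 'm) \<Rightarrow> bool" where
  "nonzero_divisible_module \<phi> act \<longleftrightarrow>
     right_module \<phi> act \<and> (\<exists>x::'m. x \<noteq> 0) \<and> divisible_module act"

definition ann :: "('m::ab_group_add \<Rightarrow> 'r \<Rightarrow> 'm) \<Rightarrow> 'r \<Rightarrow> 'm set" where
  "ann act r = {x. act x r = 0}"

text \<open>All infinite cardinals are identified.\<close>

definition ecard :: "'a set \<Rightarrow> enat" where
  "ecard A = (if finite A then enat (card A) else \<infinity>)"


section \<open>The first-order language of right modules\<close>

text \<open>Variables are named by natural numbers; there is one unary function symbol per scalar.\<close>

datatype 'r tm =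
    Var nat
  | Zero
  | Plus "'r tm" "'r tm"
  | Minus "'r tm"
  | Act "'r tm" 'r

datatype 'r fm =
    Eq "'r tm" "'r tm"
  | Neg "'r fm"
  | Conj "'r fm" "'r fm"
  | Exists nat "'r fm"

definition Iff :: "'r fm \<Rightarrow> 'r fm \<Rightarrow> 'r fm" where
  "Iff F G = Conj (Neg (Conj F (Neg G))) (Neg (Conj G (Neg F)))"

definition Forall :: "nat \<Rightarrow> 'r fm \<Rightarrow> 'r fm" where
  "Forall n F = Neg (Exists n (Neg F))"

primrec fv_tm :: "'r tm \<Rightarrow> nat set" where
  "fv_tm (Var n) = {n}"
| "fv_tm Zero = {}"
| "fv_tm (Plus a b) = fv_tm a \<union> fv_tm b"
| "fv_tm (Minus a) = fv_tm a"
| "fv_tm (Act a r) = fv_tm a"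

primrec fv :: "'r fm \<Rightarrow> nat set" where
  "fv (Eq a b) = fv_tm a \<union> fv_tm b"
| "fv (Neg F) = fv F"
| "fv (Conj F G) = fv F \<union> fv G"
| "fv (Exists n F) = fv F - {n}"

primrec quantifier_free :: "'r fm \<Rightarrow> bool" where
  "quantifier_free (Eq a b) = True"
| "quantifier_free (Neg F) = quantifier_free F"
| "quantifier_free (Conj F G) = (quantifier_free F \<and> quantifier_free G)"
| "quantifier_free (Exists n F) = False"

definition sentence :: "'r fm \<Rightarrow> bool" where
  "sentence F \<longleftrightarrow> fv F = {}"

definition univ_closure :: "'r fm \<Rightarrow> 'r fm" where
  "univ_closure F = foldr Forall (sorted_list_of_set (fv F)) F"

primrec eval_tm :: "('m::ab_group_add \<Rightarrow> 'r \<Rightarrow> 'm) \<Rightarrow> (nat \<Rightarrow> 'm) \<Rightarrow> 'r tm \<Rightarrow> 'm" where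
  "eval_tm act e (Var n) = e n"
| "eval_tm act e Zero = 0"
| "eval_tm act e (Plus a b) = eval_tm act e a + eval_tm act e b"
| "eval_tm act e (Minus a) = - eval_tm act e a"
| "eval_tm act e (Act a r) = act (eval_tm act e a) r"

primrec sat :: "('m::ab_group_add \<Rightarrow> 'r \<Rightarrow> 'm) \<Rightarrow> (nat \<Rightarrow> 'm) \<Rightarrow> 'r fm \<Rightarrow> bool" where
  "sat act e (Eq a b) \<longleftrightarrow> eval_tm act e a = eval_tm act e b"
| "sat act e (Neg F) \<longleftrightarrow> \<not> sat act e F"
| "sat act e (Conj F G) \<longleftrightarrow> sat act e F \<and> sat act e G"
| "sat act e (Exists n F) \<longleftrightarrow> (\<exists>x. sat act (e(n := x)) F)"


section \<open>Theories\<close>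

definition Th :: "('m::ab_group_add \<Rightarrow> 'r \<Rightarrow> 'm) \<Rightarrow> 'r fm set" where
  "Th act = {F. sentence F \<and> (\<forall>e. sat act e F)}"

definition is_model :: "('m::ab_group_add \<Rightarrow> 'r \<Rightarrow> 'm) \<Rightarrow> 'r fm set \<Rightarrow> bool" where
  "is_model act T \<longleftrightarrow> (\<forall>F\<in>T. \<forall>e. sat act e F)"

definition elementarily_equivalent ::
    "('m::ab_group_add \<Rightarrow> 'r \<Rightarrow> 'm) \<Rightarrow> ('n::ab_group_add \<Rightarrow> 'r \<Rightarrow> 'n) \<Rightarrow> bool" where
  "elementarily_equivalent act act' \<longleftrightarrow> Th act = Th act'"

text \<open>
  A theory is understood to contain all its consequences, so that completeness and provability
  are expressed by membership. Consistency is not part of the definition of completeness: it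
  comes from the existence of a model.
\<close>

definition complete_theory :: "'r fm set \<Rightarrow> bool" where
  "complete_theory T \<longleftrightarrow>
     (\<forall>F\<in>T. sentence F) \<and> (\<forall>F. sentence F \<longrightarrow> F \<in> T \<or> Neg F \<in> T)"

definition admits_qe :: "'r fm set \<Rightarrow> bool" where
  "admits_qe T \<longleftrightarrow>
     (\<forall>F. \<exists>G. quantifier_free G \<and> fv G \<subseteq> fv F \<and> univ_closure (Iff F G) \<in> T)"

lemma complete_theory_Th: "complete_theory (Th act)"
proof -
  have tm: "eval_tm act e a = eval_tm act e' a" if "\<And>n. n \<in> fv_tm a \<Longrightarrow> e n = e' n" for e e' a
    using that by (induction a) auto
  have "sat act e F = sat act e' F" if "\<And>n. n \<in> fv F \<Longrightarrow> e n = e' n" for e e' F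
    using that
  proof (induction F arbitrary: e e')
    case (Eq a b)
    then show ?case using tm[of a e e'] tm[of b e e'] by simp
  next
    case (Exists n F)
    have "sat act (e(n := x)) F = sat act (e'(n := x)) F" for x
      by (rule Exists.IH) (use Exists.prems in auto)
    then show ?case by simp
  next
    case (Neg F)
    then show ?case by (metis fv.simps(2) sat.simps(2))
  next
    case (Conj F G)
    then show ?case by (metis UnI1 UnI2 fv.simps(3) sat.simps(3))
  qed
  then have "sat act e F = sat act e' F" if "sentence F" for e e' F
    using that unfolding sentence_def by blast
  moreover have "sentence (Neg F) = sentence F" for F :: "'a fm"
    by (simp add: sentence_def)
  ultimately show ?thesis
    unfolding complete_theory_def Th_def by auto
qed

lemma complete_theory_eq_Th:
  assumes "complete_theory T" "is_model act T"
  shows "T = Th act"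
  using assms unfolding complete_theory_def is_model_def Th_def by fastforce

end

theory Submission
  imports Defs
begin

text \<open>
  \<open>R = K[t;\<phi>]\<close> has right division, so a system of equations \<open>y s\<^sub>k = b\<^sub>k\<close> amounts to a single
  equation \<open>y g = b\<close> with conditions on the \<open>b\<^sub>k\<close>, and \<open>y g = b\<close> is solvable by divisibility.
  Whether some \<open>y\<close> satisfies exactly the equations in \<open>J\<close> is therefore the question whether a
  coset of \<open>ann g\<close> is covered by finitely many cosets of smaller annihilators. Neumann's lemma
  leaves only those of finite index, and inclusion-exclusion decides the question from the indices
  and from which intersections are empty. The indices are cardinalities \<open>|ann u|\<close>, since
  \<open>ann (h u) / ann h\<close> is isomorphic to \<open>ann u\<close>, and these are multiplicative in \<open>u\<close>, hence
  determined by the irreducibles.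
\<close>

section \<open>Right division and common left divisors\<close>

context
  fixes \<phi> :: "'k::field \<Rightarrow> 'k"
  assumes endo: "ring_endomorphism \<phi>"
begin

lemma endo_pow_zero: "(\<phi> ^^ j) 0 = 0"
  by (induction j) (simp_all add: ring_endomorphism_zero[OF endo])

text \<open>A ring endomorphism of a field is injective: a nonzero element is invertible, and so is
  its image.\<close>

lemma endo_pow_nonzero: "a \<noteq> 0 \<Longrightarrow> (\<phi> ^^ j) a \<noteq> 0"
proof (induction j)
  case (Suc j)
  let ?b = "(\<phi> ^^ j) a"
  have "\<phi> ?b * \<phi> (1 / ?b) = \<phi> (?b * (1 / ?b))"
    using endo by (metis ring_endomorphism_def)
  also have "\<dots> = 1"
    using endo Suc by (simp add: ring_endomorphism_def)
  finally show ?case by auto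
qed simp

lemma skew_mult_add_right: "skew_mult \<phi> p (q + r) = skew_mult \<phi> p q + skew_mult \<phi> p r"
  by (rule poly_eqI) (simp add: coeff_skew_mult[OF endo] distrib_left sum.distrib)

lemma skew_mult_zero_right: "skew_mult \<phi> p 0 = 0"
  by (rule poly_eqI) (simp add: coeff_skew_mult[OF endo])

lemma skew_mult_zero_left: "skew_mult \<phi> 0 p = 0"
  by (rule poly_eqI) (simp add: coeff_skew_mult[OF endo] endo_pow_zero)

lemma skew_mult_minus_right: "skew_mult \<phi> p (- q) = - skew_mult \<phi> p q"
  by (rule poly_eqI) (simp add: coeff_skew_mult[OF endo] sum_negf)

lemma coeff_skew_mult_top:
  "coeff (skew_mult \<phi> p q) (degree p + degree q)
    = (\<phi> ^^ degree q) (lead_coeff p) * lead_coeff q"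
proof -
  let ?k = "degree p + degree q"
  have "coeff (skew_mult \<phi> p q) ?k
      = (\<Sum>i\<le>?k. if i = degree p then (\<phi> ^^ degree q) (lead_coeff p) * lead_coeff q else 0)"
    unfolding coeff_skew_mult[OF endo]
  proof (rule sum.cong[OF refl])
    fix i assume "i \<in> {..?k}"
    consider "i < degree p" | "i = degree p" | "i > degree p" by linarith
    then show "(\<phi> ^^ (?k - i)) (coeff p i) * coeff q (?k - i)
      = (if i = degree p then (\<phi> ^^ degree q) (lead_coeff p) * lead_coeff q else 0)"
      by cases (auto simp: coeff_eq_0 endo_pow_zero)
  qed
  then show ?thesis by simp
qed

lemma degree_skew_mult_le: "degree (skew_mult \<phi> p q) \<le> degree p + degree q"
proof (rule degree_le, intro allI impI)
  fix k assume k: "degree p + degree q < k"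
  show "coeff (skew_mult \<phi> p q) k = 0"
    unfolding coeff_skew_mult[OF endo]
  proof (rule sum.neutral, rule ballI)
    fix i assume "i \<in> {..k}"
    have "degree p < i \<or> degree q < k - i" using k by linarith
    then show "(\<phi> ^^ (k - i)) (coeff p i) * coeff q (k - i) = 0"
      by (auto simp: coeff_eq_0 endo_pow_zero)
  qed
qed

lemma degree_skew_mult:
  assumes "p \<noteq> 0" "q \<noteq> 0"
  shows "degree (skew_mult \<phi> p q) = degree p + degree q"
proof (rule antisym[OF degree_skew_mult_le le_degree])
  show "coeff (skew_mult \<phi> p q) (degree p + degree q) \<noteq> 0"
    using assms by (simp add: coeff_skew_mult_top endo_pow_nonzero)
qed

text \<open>Subtracting \<open>g\<close> times a monomial cancels the leading term of
  \<open>f\<close>. With the quotient on the right, \<phi> acts on the coefficients of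
  \<open>g\<close>, so it suffices to divide by an iterated image of \<open>lead_coeff g\<close>; a
  quotient on the left would require preimages under \<phi>, which need not be surjective.\<close>

lemma skew_division:
  assumes g: "g \<noteq> 0"
  shows "\<exists>c r. f = skew_mult \<phi> g c + r \<and> (r = 0 \<or> degree r < degree g)"
proof (induction "degree f" arbitrary: f rule: less_induct)
  case less
  show ?case
  proof (cases "f = 0 \<or> degree f < degree g")
    case True
    then show ?thesis
      by (intro exI[of _ 0] exI[of _ f]) (simp add: skew_mult_zero_right)
  next
    case False
    let ?i = "degree f - degree g"
    let ?l = "(\<phi> ^^ ?i) (lead_coeff g)"
    define m where "m = monom (lead_coeff f / ?l) ?i"
    define f' where "f' = f - skew_mult \<phi> g m"
    have l: "?l \<noteq> 0" using g by (simp add: endo_pow_nonzero)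
    have dm: "degree m = ?i" "lead_coeff m = lead_coeff f / ?l" "m \<noteq> 0"
      using False l by (auto simp: m_def degree_monom_eq)
    have df: "degree f = degree g + degree m" using False dm by simp
    have "coeff (skew_mult \<phi> g m) (degree g + degree m) = lead_coeff f"
      unfolding coeff_skew_mult_top using l dm by simp
    then have "coeff (skew_mult \<phi> g m) (degree f) = lead_coeff f" by (simp only: df)
    then have c0: "coeff f' (degree f) = 0" by (simp add: f'_def)
    have le: "degree f' \<le> degree f"
      unfolding f'_def using df degree_skew_mult[OF g \<open>m \<noteq> 0\<close>] by (intro degree_diff_le) auto
    have f: "f = skew_mult \<phi> g m + f'" by (simp add: f'_def)
    show ?thesis
    proof (cases "f' = 0")
      case True
      then show ?thesis using f by blast
    next
      case False
      then have "degree f' < degree f"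
        using le c0 by (metis le_neq_implies_less leading_coeff_0_iff)
      from less[OF this] obtain c r where
        "f' = skew_mult \<phi> g c + r" "r = 0 \<or> degree r < degree g" by blast
      then show ?thesis
        using f by (intro exI[of _ "m + c"] exI[of _ r]) (simp add: skew_mult_add_right)
    qed
  qed
qed

lemma skew_unit_constant:
  assumes "p \<noteq> 0" "degree p = 0"
  shows "skew_unit \<phi> p"
proof -
  obtain c where c: "p = [:c:]" using assms(2) by (metis degree_eq_zeroE)
  then have "c \<noteq> 0" using assms(1) by auto
  then show ?thesis
    unfolding skew_unit_def c
    by (intro exI[of _ "[:1 / c:]"]) (simp add: skew_mult_def monom_0 one_pCons)
qed

end

text \<open>A pair \<open>(p, u)\<close> in the following set records that the equation \<open>y p = u\<close> is a right-linear
  consequence of the equations \<open>y s = b\<close> with \<open>(s, b) \<in> E\<close>.\<close>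

inductive_set consequences ::
    "('k::field \<Rightarrow> 'k) \<Rightarrow> ('k poly \<times> 'k poly tm) set \<Rightarrow> ('k poly \<times> 'k poly tm) set"
  for \<phi> E where
  base: "e \<in> E \<Longrightarrow> e \<in> consequences \<phi> E"
| zero: "(0, Zero) \<in> consequences \<phi> E"
| plus: "(p, u) \<in> consequences \<phi> E \<Longrightarrow> (q, v) \<in> consequences \<phi> E \<Longrightarrow>
    (p + q, Plus u v) \<in> consequences \<phi> E"
| act: "(p, u) \<in> consequences \<phi> E \<Longrightarrow> (skew_mult \<phi> p c, Act u c) \<in> consequences \<phi> E"

lemma fv_consequences:
  "d \<in> consequences \<phi> E \<Longrightarrow> fv_tm (snd d) \<subseteq> (\<Union>e\<in>E. fv_tm (snd e))"
  by (induction rule: consequences.induct) force+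

text \<open>The condition for \<open>fst d = 0\<close> keeps the equation \<open>y (fst d) = snd d\<close> solvable.\<close>

definition generates ::
    "('k::field \<Rightarrow> 'k) \<Rightarrow> ('k poly \<times> 'k poly tm) set \<Rightarrow> 'k poly \<times> 'k poly tm \<Rightarrow> bool" where
  "generates \<phi> E d \<longleftrightarrow> d \<in> consequences \<phi> E \<and> (fst d = 0 \<longrightarrow> snd d = Zero) \<and>
     (\<forall>e\<in>E. \<exists>u. fst e = skew_mult \<phi> (fst d) u)"

text \<open>The first components of consequences form a right ideal, so a nonzero one of least
  degree divides them all on the left; the right-hand sides are carried along through every
  combination.\<close>

lemma generates_exists:
  assumes "ring_endomorphism \<phi>"
  shows "\<exists>d. generates \<phi> E d"
proof (cases "\<exists>d\<in>consequences \<phi> E. fst d \<noteq> 0")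
  case False
  then have "fst e = skew_mult \<phi> 0 0" if "e \<in> E" for e
    using that consequences.base[of e E \<phi>] skew_mult_zero_left[OF assms] by auto
  then show ?thesis
    by (intro exI[of _ "(0, Zero)"]) (auto simp: generates_def intro: consequences.zero)
next
  case True
  then obtain d where d: "d \<in> consequences \<phi> E" "fst d \<noteq> 0"
    and min: "\<And>d'. d' \<in> consequences \<phi> E \<Longrightarrow> fst d' \<noteq> 0 \<Longrightarrow> degree (fst d) \<le> degree (fst d')"
    using ex_has_least_nat[of "\<lambda>d. d \<in> consequences \<phi> E \<and> fst d \<noteq> 0" _ "\<lambda>d. degree (fst d)"]
    by blast
  obtain g t where gt: "d = (g, t)" by (cases d)
  have "\<exists>u. fst e = skew_mult \<phi> g u" if e: "e \<in> E" for e
  proof -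
    obtain s b where sb: "e = (s, b)" by (cases e)
    obtain c r where r: "s = skew_mult \<phi> g c + r" "r = 0 \<or> degree r < degree g"
      using skew_division[OF assms, of g s] d gt by auto
    \<comment> \<open>The remainder is itself the first component of a consequence, so minimality of
      the degree forces it to vanish.\<close>
    have "(s + skew_mult \<phi> g (- c), Plus b (Act t (- c))) \<in> consequences \<phi> E"
      using e d(1) unfolding sb gt
      by (auto intro: consequences.plus consequences.act consequences.base)
    moreover have "s + skew_mult \<phi> g (- c) = r"
      using r by (simp add: skew_mult_minus_right[OF assms])
    ultimately have "r = 0 \<or> degree g \<le> degree r" using min gt by fastforce
    with r have "r = 0" by auto
    then show ?thesis using r sb by auto
  qed
  then show ?thesis using d unfolding gt by (intro exI[of _ "(g, t)"]) (auto simp: generates_def)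
qed


section \<open>Annihilators in divisible modules\<close>

context right_module
begin

lemma act_zero_left: "act 0 r = 0"
  using act_add_left[of 0 0 r] by simp

lemma act_zero_right: "act x 0 = 0"
  using act_add_right[of x 0 0] by simp

lemma act_minus_left: "act (- x) r = - act x r"
  using act_add_left[of x "- x" r] by (simp add: act_zero_left eq_neg_iff_add_eq_0 add.commute)

lemma act_minus_right: "act x (- r) = - act x r"
  using act_add_right[of x r "- r"] by (simp add: act_zero_right eq_neg_iff_add_eq_0 add.commute)

lemma act_diff_left: "act (x - y) r = act x r - act y r"
  using act_add_left[of x "- y" r] by (simp add: act_minus_left)

lemma act_diff_right: "act x (r - s) = act x r - act x s"
  using act_add_right[of x r "- s"] by (simp add: act_minus_right)

lemma eval_consequences:
  assumes "(p, u) \<in> consequences \<phi> E" "\<And>s b. (s, b) \<in> E \<Longrightarrow> act y s = eval_tm act e b"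
  shows "act y p = eval_tm act e u"
proof -
  have "act y (fst d) = eval_tm act e (snd d)" if "d \<in> consequences \<phi> E" for d
    using that
  proof (induction rule: consequences.induct)
    case (base d)
    then show ?case using assms(2)[of "fst d" "snd d"] by simp
  qed (simp_all add: act_zero_right act_add_right act_mult)
  then show ?thesis using assms(1) by fastforce
qed

end

section \<open>Solution sets of systems and cardinalities of annihilators\<close>

definition solutions ::
    "('m::ab_group_add \<Rightarrow> 'r \<Rightarrow> 'm) \<Rightarrow> ('i \<Rightarrow> 'r) \<Rightarrow> ('i \<Rightarrow> 'm) \<Rightarrow> 'i set \<Rightarrow> 'm set" where
  "solutions X s b J = {z. \<forall>k\<in>J. X z (s k) = b k}"

text \<open>A greatest common left divisor, that is, a generator of the right ideal spanned by the
  \<open>s k\<close>. With all right-hand sides \<open>Zero\<close>, the term \<open>t\<close>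
  evaluates to 0 in every module, so the homogeneous system collapses to one equation.\<close>

definition gcd_of :: "('k::field \<Rightarrow> 'k) \<Rightarrow> ('i \<Rightarrow> 'k poly) \<Rightarrow> 'i set \<Rightarrow> 'k poly \<Rightarrow> bool" where
  "gcd_of \<phi> s J g \<longleftrightarrow> (\<exists>t. generates \<phi> ((\<lambda>k. (s k, Zero)) ` J) (g, t))"

lemma gcd_of_exists:
  assumes "ring_endomorphism \<phi>"
  obtains g where "gcd_of \<phi> s J g"
  using generates_exists[OF assms] unfolding gcd_of_def by (metis surj_pair)

lemma gcd_of_divides: "gcd_of \<phi> s J g \<Longrightarrow> k \<in> J \<Longrightarrow> \<exists>u. s k = skew_mult \<phi> g u"
  by (auto simp: gcd_of_def generates_def)

lemma ecard_bij_betw: "bij_betw f A B \<Longrightarrow> ecard A = ecard B"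
  by (simp add: ecard_def bij_betw_finite bij_betw_same_card)

lemma ecard_inj_on: "inj_on f A \<Longrightarrow> ecard (f ` A) = ecard A"
  by (metis ecard_bij_betw inj_on_imp_bij_betw)

lemma ecard_eqD: "ecard A = ecard B \<Longrightarrow> finite A = finite B \<and> card A = card B"
  by (auto simp: ecard_def split: if_splits)

lemma ecard_Times:
  assumes "A \<noteq> {}" "B \<noteq> {}"
  shows "ecard (A \<times> B) = ecard A * ecard B"
proof (cases "finite A \<and> finite B")
  case True
  then show ?thesis by (simp add: ecard_def card_cartesian_product)
next
  case False
  then have "infinite (A \<times> B)" using assms by (auto dest: finite_cartesian_productD1 finite_cartesian_productD2)
  moreover have "ecard A \<noteq> 0" "ecard B \<noteq> 0"
    using assms by (auto simp: ecard_def zero_enat_def)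
  moreover have "ecard A = \<infinity> \<or> ecard B = \<infinity>" using False by (auto simp: ecard_def)
  ultimately show ?thesis by (auto simp: ecard_def[of "A \<times> B"] imult_infinity imult_infinity_right)
qed

context right_module
begin

lemma solutions_gcd_of:
  assumes "gcd_of \<phi> s J g"
  shows "solutions act s (\<lambda>_. 0) J = ann act g"
proof -
  obtain t where t: "generates \<phi> ((\<lambda>k. (s k, Zero)) ` J) (g, t)"
    using assms by (auto simp: gcd_of_def)
  show ?thesis
  proof (intro equalityI subsetI)
    fix z assume z: "z \<in> solutions act s (\<lambda>_. 0) J"
    have "(g, t) \<in> consequences \<phi> ((\<lambda>k. (s k, Zero)) ` J)"
      using t by (simp add: generates_def)
    then have 1: "act z g = eval_tm act (\<lambda>_. 0) t"
      by (rule eval_consequences) (use z in \<open>auto simp: solutions_def\<close>)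
    have "(g, t) \<in> consequences \<phi> ((\<lambda>k. (s k, Zero)) ` J)"
      using t by (simp add: generates_def)
    \<comment> \<open>The trivial solution 0 shows that \<open>t\<close> evaluates to 0.\<close>
    then have "act 0 g = eval_tm act (\<lambda>_. 0) t"
      by (rule eval_consequences) (auto simp: act_zero_left)
    with 1 show "z \<in> ann act g" by (simp add: ann_def act_zero_left)
  next
    fix z assume z: "z \<in> ann act g"
    have "act z (s k) = 0" if k: "k \<in> J" for k
    proof -
      obtain u where "s k = skew_mult \<phi> g u"
        using t k by (auto simp: generates_def)
      then show ?thesis using z by (simp add: act_mult ann_def act_zero_left)
    qed
    then show "z \<in> solutions act s (\<lambda>_. 0) J" by (simp add: solutions_def)
  qed
qed

lemma solutions_coset:
  assumes "z0 \<in> solutions act s b J"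
  shows "solutions act s b J = (+) z0 ` solutions act s (\<lambda>_. 0) J"
proof (intro equalityI subsetI)
  fix z assume "z \<in> solutions act s b J"
  then have "z - z0 \<in> solutions act s (\<lambda>_. 0) J"
    using assms by (auto simp: solutions_def act_diff_left)
  then have "z0 + (z - z0) \<in> (+) z0 ` solutions act s (\<lambda>_. 0) J" by (rule imageI)
  then show "z \<in> (+) z0 ` solutions act s (\<lambda>_. 0) J" by simp
qed (use assms in \<open>auto simp: solutions_def act_add_left\<close>)

lemma ecard_image_solutions:
  assumes "solutions act s b J \<noteq> {}"
  shows "ecard ((\<lambda>x. act x h) ` solutions act s b J)
    = ecard ((\<lambda>x. act x h) ` solutions act s (\<lambda>_. 0) J)"
proof -
  obtain z0 where z0: "z0 \<in> solutions act s b J" using assms by auto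
  have "(\<lambda>x. act x h) ` solutions act s b J
      = (+) (act z0 h) ` (\<lambda>x. act x h) ` solutions act s (\<lambda>_. 0) J"
    unfolding solutions_coset[OF z0] image_image by (simp add: act_add_left)
  then show ?thesis by (simp add: ecard_inj_on)
qed

text \<open>The polynomials whose action has finite image on \<open>V\<close> form a right
  ideal.\<close>

lemma finite_image_consequences:
  assumes "d \<in> consequences \<phi> ((\<lambda>k. (s k, Zero)) ` J)"
    and "\<And>k. k \<in> J \<Longrightarrow> finite ((\<lambda>x. act x (s k)) ` V)"
  shows "finite ((\<lambda>x. act x (fst d)) ` V)"
  using assms(1)
proof (induction rule: consequences.induct)
  case (base e)
  then show ?case using assms(2) by auto
next
  case zero
  have "(\<lambda>x. act x 0) ` V \<subseteq> {0}" by (auto simp: act_zero_right)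
  then show ?case by (simp add: finite_subset)
next
  case (plus p u q v)
  have "(\<lambda>x. act x (p + q)) ` V
      \<subseteq> (\<lambda>(a, b). a + b) ` ((\<lambda>x. act x p) ` V \<times> (\<lambda>x. act x q) ` V)"
    by (auto simp: act_add_right)
  then show ?case unfolding fst_conv by (rule finite_subset) (use plus.IH in simp)
next
  case (act p u c)
  have "(\<lambda>x. act x (skew_mult \<phi> p c)) ` V = (\<lambda>y. act y c) ` (\<lambda>x. act x p) ` V"
    by (simp add: image_image act_mult)
  then show ?case using act by simp
qed

text \<open>On \<open>ann act g\<close>, acting by \<open>h\<close> has kernel
  \<open>ann act d\<close>. Acting by \<open>d\<close> has the same kernel and maps
  \<open>ann act g\<close> onto \<open>ann act u\<close>, where surjectivity comes from divisibility
  by \<open>d\<close>.\<close>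

lemma ecard_image_ann:
  assumes "divisible_module act"
    and "g = skew_mult \<phi> d u" "h = skew_mult \<phi> d v" "d \<noteq> 0"
    and gcd: "\<And>z. act z g = 0 \<Longrightarrow> act z h = 0 \<Longrightarrow> act z d = 0"
  shows "ecard ((\<lambda>x. act x h) ` ann act g) = ecard (ann act u)"
proof -
  have div: "\<exists>z. act z d = w" for w
    using assms(1,4) by (auto simp: divisible_module_def)
  have inj: "inj_on (\<lambda>w. act w v) (ann act u)"
  proof (rule inj_onI)
    fix w w' assume w: "w \<in> ann act u" "w' \<in> ann act u" "act w v = act w' v"
    obtain z where z: "act z d = w - w'" using div by blast
    have "act z g = 0" "act z h = 0"
      using w by (simp_all add: assms(2,3) act_mult z act_diff_left ann_def)
    from gcd[OF this] z show "w = w'" by simp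
  qed
  have "(\<lambda>w. act w v) ` ann act u = (\<lambda>x. act x h) ` ann act g"
  proof (intro equalityI subsetI)
    fix y assume "y \<in> (\<lambda>w. act w v) ` ann act u"
    then obtain w where w: "act w u = 0" "y = act w v" by (auto simp: ann_def)
    obtain z where "act z d = w" using div by blast
    then show "y \<in> (\<lambda>x. act x h) ` ann act g"
      using w by (intro image_eqI[of _ _ z]) (auto simp: assms(2,3) act_mult ann_def)
  next
    fix y assume "y \<in> (\<lambda>x. act x h) ` ann act g"
    then obtain z where "act z g = 0" "y = act z h" by (auto simp: ann_def)
    then show "y \<in> (\<lambda>w. act w v) ` ann act u"
      by (intro image_eqI[of _ _ "act z d"]) (auto simp: assms(2,3) act_mult ann_def)
  qed
  then show ?thesis using ecard_inj_on[OF inj] by simp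
qed

text \<open>Acting by \<open>a\<close> maps the annihilator of the product onto
  \<open>ann act b\<close> with kernel \<open>ann act a\<close>. The section \<open>\<sigma>\<close>
  comes from divisibility; it may fail to be additive, since only cardinalities are
  compared.\<close>

lemma ecard_ann_mult:
  assumes "divisible_module act" "a \<noteq> 0"
  shows "ecard (ann act (skew_mult \<phi> a b)) = ecard (ann act a) * ecard (ann act b)"
proof -
  have "\<forall>y. \<exists>z. act z a = y" using assms by (simp add: divisible_module_def)
  from choice[OF this] obtain \<sigma> where \<sigma>: "\<And>y. act (\<sigma> y) a = y" by blast
  have "bij_betw (\<lambda>(x, y). x + \<sigma> y) (ann act a \<times> ann act b) (ann act (skew_mult \<phi> a b))"
    by (rule bij_betw_byWitness[where f' = "\<lambda>z. (z - \<sigma> (act z a), act z a)"])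
      (auto simp: ann_def act_add_left act_diff_left act_mult \<sigma>)
  then have "ecard (ann act a \<times> ann act b) = ecard (ann act (skew_mult \<phi> a b))"
    by (rule ecard_bij_betw)
  moreover have "0 \<in> ann act a" "0 \<in> ann act b" by (simp_all add: ann_def act_zero_left)
  then have "ecard (ann act a \<times> ann act b) = ecard (ann act a) * ecard (ann act b)"
    by (intro ecard_Times) blast+
  ultimately show ?thesis by simp
qed

lemma ann_unit:
  assumes "skew_unit \<phi> u"
  shows "ann act u = {0}"
proof -
  obtain v where "skew_mult \<phi> u v = 1" using assms by (auto simp: skew_unit_def)
  then have "x = act (act x u) v" for x by (metis act_mult act_one)
  then have "x = 0" if "act x u = 0" for x using that by (metis act_zero_left)
  then show ?thesis by (auto simp: ann_def act_zero_left)
qed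

text \<open>In a finite divisible module every nonzero polynomial acts surjectively, hence
  injectively, so \<open>act x\<close> would embed the infinite ring into the module. This settles
  the invariant at the polynomial 0, whose annihilator is the whole module.\<close>

lemma infinite_divisible_module:
  assumes "divisible_module act" and "x \<noteq> (0::'m)"
  shows "infinite (UNIV :: 'm set)"
proof
  assume fin: "finite (UNIV :: 'm set)"
  have "inj (act x)"
  proof (rule injI, rule ccontr)
    fix r s assume eq: "act x r = act x s" and "r \<noteq> s"
    then have "surj (\<lambda>z. act z (r - s))"
      using assms(1) unfolding divisible_module_def surj_def by (metis right_minus_eq)
    then have "inj (\<lambda>z. act z (r - s))" by (rule finite_UNIV_surj_inj[OF fin])
    moreover have "act x (r - s) = act 0 (r - s)"
      using eq by (simp add: act_diff_right act_zero_left)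
    ultimately have "x = 0" by (rule injD)
    then show False using assms(2) by simp
  qed
  then have "finite (UNIV :: 'k poly set)" using fin by (metis finite_imageD finite_subset subset_UNIV)
  moreover have "inj (\<lambda>n. monom (1::'k) n)"
    by (rule injI) (metis degree_monom_eq zero_neq_one)
  ultimately show False
    by (metis finite_imageD finite_subset infinite_UNIV_nat subset_UNIV)
qed

end


section \<open>Coverings by cosets\<close>

text \<open>B. H. Neumann's covering lemma, with the cosets given as fibres of additive maps.\<close>

lemma finite_image_of_covering:
  fixes f :: "'i \<Rightarrow> 'm::ab_group_add \<Rightarrow> 'n::ab_group_add"
  assumes "finite I" "H \<noteq> {}" "\<And>x y. x \<in> H \<Longrightarrow> y \<in> H \<Longrightarrow> x + y \<in> H"
    and "\<And>x y. x \<in> H \<Longrightarrow> y \<in> H \<Longrightarrow> x - y \<in> H"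
    and add: "\<And>i x y. f i (x + y) = f i x + f i y"
    and "\<And>i. i \<in> I \<Longrightarrow> finite (C i)"
    and "\<And>v. v \<in> H \<Longrightarrow> \<exists>i\<in>I. f i v \<in> C i"
  shows "\<exists>i\<in>I. finite (f i ` H)"
  using assms(1,6,7)
proof (induction I arbitrary: C rule: finite_induct)
  case empty
  then show ?case using assms(2) by auto
next
  case (insert k I)
  have diff: "f i (x - y) = f i x - f i y" for i x y
    using add[of i "x - y" y] by (simp add: algebra_simps)
  show ?case
  proof (cases "finite (f k ` H)")
    case False
    then have "\<not> f k ` H \<subseteq> C k" using insert.prems(1) finite_subset by blast
    \<comment> \<open>The fibre of \<open>f k\<close> through \<open>x\<close> avoids
      \<open>C k\<close> and is therefore covered by the remaining maps. The elements with
      \<open>f k v\<close> in \<open>C k\<close> lie in finitely many fibres, each a translate of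
      this one.\<close>
    then obtain x where x: "x \<in> H" "f k x \<notin> C k" by auto
    obtain \<sigma> where \<sigma>: "\<And>v. v \<in> H \<Longrightarrow> \<sigma> (f k v) \<in> H \<and> f k (\<sigma> (f k v)) = f k v"
    proof -
      have "\<exists>w. v \<in> H \<longrightarrow> w \<in> H \<and> f k w = f k v" for v by auto
      then show ?thesis using that[of "\<lambda>c. SOME w. w \<in> H \<and> f k w = c"]
        by (smt (verit, best) someI)
    qed
    \<comment> \<open>Besides the old values, \<open>D i\<close> collects those on the covered fibre
      after translation to the fibres over \<open>C k\<close>.\<close>
    define D where "D i = C i \<union> (\<lambda>(c, d). c + f i (\<sigma> d) - f i x) ` (C i \<times> C k)" for i
    have "\<exists>i\<in>I. finite (f i ` H)"
    proof (rule insert.IH[of D])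
      show "finite (D i)" if "i \<in> I" for i
        using that insert.prems(1) by (auto simp: D_def)
    next
      fix v assume v: "v \<in> H"
      show "\<exists>i\<in>I. f i v \<in> D i"
      proof (cases "f k v \<in> C k")
        case True
        let ?w = "x + (v - \<sigma> (f k v))"
        have "?w \<in> H" using assms(3,4) v x \<sigma> by blast
        moreover have "f k ?w = f k x" using v \<sigma> by (simp add: add diff)
        ultimately obtain i where i: "i \<in> I" "f i ?w \<in> C i"
          using insert.prems(2)[of ?w] x by auto
        have "f i v = f i ?w + f i (\<sigma> (f k v)) - f i x" by (simp add: add diff)
        then have "f i v \<in> D i" using i True unfolding D_def by force
        then show ?thesis using i by blast
      next
        case False
        then show ?thesis using insert.prems(2)[OF v] by (auto simp: D_def)
      qed
    qed
    then show ?thesis by blast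
  qed auto
qed

text \<open>Inclusion-exclusion without alternating sums: \<open>card_Un_Int\<close> reduces the
  claim to the shorter families \<open>A i\<close> and \<open>A a \<inter> A i\<close>, whose
  intersections are again intersections of the original family.\<close>

lemma card_UN_eq_of_card_INT_eq:
  fixes A :: "'i \<Rightarrow> 'a set" and B :: "'i \<Rightarrow> 'b set"
  assumes "finite F" "\<And>i. i \<in> F \<Longrightarrow> finite (A i)" "\<And>i. i \<in> F \<Longrightarrow> finite (B i)"
    and "\<And>I. I \<subseteq> F \<Longrightarrow> I \<noteq> {} \<Longrightarrow> card (\<Inter>i\<in>I. A i) = card (\<Inter>i\<in>I. B i)"
  shows "card (\<Union>i\<in>F. A i) = card (\<Union>i\<in>F. B i)"
  using assms
proof (induction F arbitrary: A B rule: finite_induct)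
  case (insert a F)
  have split: "card (\<Union>i\<in>insert a F. A i) + card (\<Union>i\<in>F. A a \<inter> A i)
      = card (A a) + card (\<Union>i\<in>F. A i)"
    using card_Un_Int[of "A a" "\<Union>i\<in>F. A i"] insert.prems(1) insert.hyps by simp
  have split': "card (\<Union>i\<in>insert a F. B i) + card (\<Union>i\<in>F. B a \<inter> B i)
      = card (B a) + card (\<Union>i\<in>F. B i)"
    using card_Un_Int[of "B a" "\<Union>i\<in>F. B i"] insert.prems(2) insert.hyps by simp
  have 1: "card (\<Union>i\<in>F. A i) = card (\<Union>i\<in>F. B i)"
    using insert.prems by (intro insert.IH) auto
  have 2: "card (\<Union>i\<in>F. A a \<inter> A i) = card (\<Union>i\<in>F. B a \<inter> B i)"
  proof (rule insert.IH)
    fix I assume I: "I \<subseteq> F" "I \<noteq> {}"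
    have "(\<Inter>i\<in>I. A a \<inter> A i) = (\<Inter>i\<in>insert a I. A i)"
      "(\<Inter>i\<in>I. B a \<inter> B i) = (\<Inter>i\<in>insert a I. B i)" using I by auto
    moreover have "card (\<Inter>i\<in>insert a I. A i) = card (\<Inter>i\<in>insert a I. B i)"
      using I by (intro insert.prems(3)) auto
    ultimately show "card (\<Inter>i\<in>I. A a \<inter> A i) = card (\<Inter>i\<in>I. B a \<inter> B i)" by simp
  qed (use insert.prems in auto)
  have 3: "card (A a) = card (B a)" using insert.prems(3)[of "{a}"] by simp
  show ?case using split split' 1 2 3 by simp
qed simp


section \<open>Realising solution patterns\<close>

definition same_invariants ::
    "('k::field \<Rightarrow> 'k) \<Rightarrow> ('m::ab_group_add \<Rightarrow> 'k poly \<Rightarrow> 'm) \<Rightarrow>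
      ('n::ab_group_add \<Rightarrow> 'k poly \<Rightarrow> 'n) \<Rightarrow> bool" where
  "same_invariants \<phi> X Y \<longleftrightarrow> ring_endomorphism \<phi> \<and>
     nonzero_divisible_module \<phi> X \<and> nonzero_divisible_module \<phi> Y \<and>
     (\<forall>u. ecard (ann X u) = ecard (ann Y u))"

lemma same_invariants_sym: "same_invariants \<phi> X Y \<Longrightarrow> same_invariants \<phi> Y X"
  by (simp add: same_invariants_def)

text \<open>Induction on the degree: the annihilator of 0 is infinite in both modules, that of a
  unit is trivial, and cardinalities multiply along a factorisation.\<close>

lemma same_invariants_irreducible:
  assumes "ring_endomorphism \<phi>" "nonzero_divisible_module \<phi> X" "nonzero_divisible_module \<phi> Y"
    and irr: "\<And>q. skew_irreducible \<phi> q \<Longrightarrow> ecard (ann X q) = ecard (ann Y q)"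
  shows "same_invariants \<phi> X Y"
proof -
  interpret X: right_module \<phi> X using assms(2) by (simp add: nonzero_divisible_module_def)
  interpret Y: right_module \<phi> Y using assms(3) by (simp add: nonzero_divisible_module_def)
  have divs: "divisible_module X" "divisible_module Y"
    using assms(2,3) by (simp_all add: nonzero_divisible_module_def)
  have "ecard (ann X u) = ecard (ann Y u)" for u
  proof (induction "degree u" arbitrary: u rule: less_induct)
    case less
    consider "u = 0" | "skew_unit \<phi> u" | "skew_irreducible \<phi> u"
      | "u \<noteq> 0" "\<not> skew_unit \<phi> u" "\<not> skew_irreducible \<phi> u" by blast
    then show ?case
    proof cases
      case 1
      have "ann X u = UNIV" "ann Y u = UNIV"
        using 1 by (simp_all add: ann_def X.act_zero_right Y.act_zero_right)
      then show ?thesis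
        using assms(2,3) X.infinite_divisible_module Y.infinite_divisible_module
        by (auto simp: nonzero_divisible_module_def ecard_def)
    next
      case 2
      then show ?thesis by (simp add: X.ann_unit Y.ann_unit ecard_def)
    next
      case 4
      then obtain a b where ab: "\<not> skew_unit \<phi> a" "\<not> skew_unit \<phi> b" "u = skew_mult \<phi> a b"
        by (auto simp: skew_irreducible_def)
      then have nz: "a \<noteq> 0" "b \<noteq> 0"
        using 4 by (auto simp: skew_mult_zero_left[OF assms(1)] skew_mult_zero_right[OF assms(1)])
      \<comment> \<open>Nonzero constants are units, so both factors have positive degree, and hence
        smaller degree than \<open>u\<close>.\<close>
      then have "degree a > 0" "degree b > 0"
        using skew_unit_constant[OF assms(1)] ab by blast+
      then have "degree a < degree u" "degree b < degree u"
        using degree_skew_mult[OF assms(1) nz] ab by simp_all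
      from less[OF this(1)] less[OF this(2)] show ?thesis
        using nz ab by (simp add: X.ecard_ann_mult Y.ecard_ann_mult divs)
    qed (simp add: irr)
  qed
  then show ?thesis using assms by (simp add: same_invariants_def)
qed

text \<open>Each side is the index of the common annihilator of \<open>g\<close> and
  \<open>h\<close> in that of \<open>g\<close>. If their greatest common left divisor
  \<open>d\<close> is nonzero, writing \<open>g\<close> as \<open>d\<close> times \<open>u\<close>
  makes this index the cardinality of the annihilator of \<open>u\<close>.\<close>

lemma ecard_image_ann_eq:
  assumes "same_invariants \<phi> X Y"
  shows "ecard ((\<lambda>x. X x h) ` ann X g) = ecard ((\<lambda>x. Y x h) ` ann Y g)"
proof -
  have mods: "ring_endomorphism \<phi>" "right_module \<phi> X" "right_module \<phi> Y" "divisible_module X" "divisible_module Y"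
    using assms by (auto simp: same_invariants_def nonzero_divisible_module_def)
  interpret X: right_module \<phi> X by (fact mods)
  interpret Y: right_module \<phi> Y by (fact mods)
  \<comment> \<open>The pair is treated as a family indexed by the booleans.\<close>
  let ?s = "\<lambda>c. if c then g else h"
  obtain d where d: "gcd_of \<phi> ?s UNIV d" by (rule gcd_of_exists[OF mods(1)])
  have "\<exists>u. g = skew_mult \<phi> d u" "\<exists>v. h = skew_mult \<phi> d v"
    using gcd_of_divides[OF d, of True] gcd_of_divides[OF d, of False] by simp_all
  then obtain u v where uv: "g = skew_mult \<phi> d u" "h = skew_mult \<phi> d v" by blast
  show ?thesis
  proof (cases "d = 0")
    case True
    then have "g = 0" "h = 0" using uv skew_mult_zero_left[OF mods(1)] by auto
    then have "(\<lambda>x. X x h) ` ann X g = {0}" "(\<lambda>x. Y x h) ` ann Y g = {0}"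
      by (auto simp: ann_def X.act_zero_right Y.act_zero_right)
    then show ?thesis by (simp add: ecard_def)
  next
    case False
    have "X z d = 0" if "X z g = 0" "X z h = 0" for z
      using X.solutions_gcd_of[OF d] that by (auto simp: solutions_def ann_def)
    moreover have "Y z d = 0" if "Y z g = 0" "Y z h = 0" for z
      using Y.solutions_gcd_of[OF d] that by (auto simp: solutions_def ann_def)
    ultimately show ?thesis
      using assms X.ecard_image_ann[OF mods(4) uv False] Y.ecard_image_ann[OF mods(5) uv False]
      by (simp add: same_invariants_def)
  qed
qed

lemma ecard_image_solutions_eq:
  assumes "same_invariants \<phi> X Y"
  shows "ecard ((\<lambda>x. X x h) ` solutions X s (\<lambda>_. 0) J)
    = ecard ((\<lambda>x. Y x h) ` solutions Y s (\<lambda>_. 0) J)"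
proof -
  have mods: "ring_endomorphism \<phi>" "right_module \<phi> X" "right_module \<phi> Y"
    using assms by (auto simp: same_invariants_def nonzero_divisible_module_def)
  obtain g where "gcd_of \<phi> s J g" by (rule gcd_of_exists[OF mods(1)])
  then show ?thesis
    using ecard_image_ann_eq[OF assms] right_module.solutions_gcd_of mods by metis
qed

text \<open>Acting by \<open>h\<close> identifies exactly the points that differ by a homogeneous
  solution of \<open>J \<union> F\<close>. Whether an equation of \<open>F\<close> holds can thus be
  read off from the image, and intersecting images agrees with intersecting solution sets.\<close>

lemma (in right_module) image_INT_solutions:
  assumes "gcd_of \<phi> s (J \<union> F) h" "I \<subseteq> F" "I \<noteq> {}"
  shows "(\<Inter>k\<in>I. (\<lambda>x. act x h) ` solutions act s b (insert k J))
    = (\<lambda>x. act x h) ` solutions act s b (J \<union> I)"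
proof (intro equalityI subsetI)
  fix w assume w: "w \<in> (\<Inter>k\<in>I. (\<lambda>x. act x h) ` solutions act s b (insert k J))"
  obtain k0 where k0: "k0 \<in> I" using assms(3) by auto
  then obtain z where z: "z \<in> solutions act s b (insert k0 J)" "w = act z h" using w by auto
  have "act z (s k) = b k" if k: "k \<in> I" for k
  proof -
    obtain z' where z': "z' \<in> solutions act s b (insert k J)" "w = act z' h" using w k by auto
    then have "z - z' \<in> ann act h" using z by (simp add: ann_def act_diff_left)
    then have "act (z - z') (s k) = 0"
      using solutions_gcd_of[OF assms(1)] k assms(2) by (auto simp: solutions_def)
    then show ?thesis using z' by (simp add: act_diff_left solutions_def)
  qed
  then have "z \<in> solutions act s b (J \<union> I)" using z by (auto simp: solutions_def)
  then show "w \<in> (\<lambda>x. act x h) ` solutions act s b (J \<union> I)" using z by blast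
qed (auto simp: solutions_def)

text \<open>\<open>h\<close> is a right combination of the \<open>s k\<close>: those with
  \<open>k\<close> in \<open>J\<close> vanish on the homogeneous solutions, the others have finite
  image by assumption.\<close>

lemma (in right_module) finite_image_gcd:
  assumes "gcd_of \<phi> s (J \<union> F) h"
    and "\<And>k. k \<in> F \<Longrightarrow> finite ((\<lambda>x. act x (s k)) ` solutions act s (\<lambda>_. 0) J)"
  shows "finite ((\<lambda>x. act x h) ` solutions act s (\<lambda>_. 0) J)"
proof -
  obtain t where "(h, t) \<in> consequences \<phi> ((\<lambda>k. (s k, Zero)) ` (J \<union> F))"
    using assms(1) by (auto simp: gcd_of_def generates_def)
  then have "finite ((\<lambda>x. act x (fst (h, t))) ` solutions act s (\<lambda>_. 0) J)"
  proof (rule finite_image_consequences)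
    fix k assume "k \<in> J \<union> F"
    moreover have "(\<lambda>x. act x (s k)) ` solutions act s (\<lambda>_. 0) J \<subseteq> {0}" if "k \<in> J"
      using that by (auto simp: solutions_def)
    ultimately show "finite ((\<lambda>x. act x (s k)) ` solutions act s (\<lambda>_. 0) J)"
      using assms(2) finite_subset by blast
  qed
  then show ?thesis by simp
qed

text \<open>Neumann's lemma discards the equations whose solution cosets have infinite index.\<close>

lemma (in right_module) covering_finite_index:
  assumes endo: "ring_endomorphism \<phi>" and "finite S"
    and cover: "\<And>y. y \<in> solutions act s b J \<Longrightarrow> \<exists>k\<in>S. act y (s k) = b k"
    and F: "F = {k\<in>S. finite ((\<lambda>x. act x (s k)) ` solutions act s (\<lambda>_. 0) J)}"
    and y0: "y0 \<in> solutions act s b J"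
  shows "\<exists>k\<in>F. act y0 (s k) = b k"
proof (rule ccontr)
  assume neg: "\<not> ?thesis"
  let ?G = "solutions act s (\<lambda>_. 0) J"
  let ?H = "solutions act s (\<lambda>_. 0) (J \<union> F)"
  \<comment> \<open>Along the coset of \<open>?H\<close> through \<open>y0\<close> the equations of
    \<open>J\<close> hold and those of \<open>F\<close> keep failing, so this coset is covered by
    the equations outside \<open>F\<close> alone.\<close>
  have "\<exists>k\<in>S - F. finite ((\<lambda>x. act x (s k)) ` ?H)"
  proof (rule finite_image_of_covering[where C = "\<lambda>k. {b k - act y0 (s k)}"])
    fix v assume v: "v \<in> ?H"
    have "y0 + v \<in> solutions act s b J" using v y0 by (auto simp: solutions_def act_add_left)
    from cover[OF this] obtain k where k: "k \<in> S" "act (y0 + v) (s k) = b k" by blast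
    moreover have "k \<notin> F"
    proof
      assume "k \<in> F"
      then have "act y0 (s k) = b k" using k v by (simp add: solutions_def act_add_left)
      then show False using neg \<open>k \<in> F\<close> by blast
    qed
    ultimately show "\<exists>k\<in>S - F. act v (s k) \<in> {b k - act y0 (s k)}"
      by (intro bexI[of _ k]) (auto simp: act_add_left algebra_simps)
  next
    show "?H \<noteq> {}" by (auto simp: solutions_def act_zero_left intro!: exI[of _ 0])
  qed (use \<open>finite S\<close> in \<open>auto simp: solutions_def act_add_left act_diff_left\<close>)
  then obtain k where k: "k \<in> S" "k \<notin> F" "finite ((\<lambda>x. act x (s k)) ` ?H)" by blast
  obtain h where h: "gcd_of \<phi> s (J \<union> F) h" by (rule gcd_of_exists[OF endo])
  have "finite ((\<lambda>x. act x h) ` ?G)"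
    using F by (intro finite_image_gcd[OF h]) blast
  then obtain T where T: "finite T" "T \<subseteq> ?G" "(\<lambda>x. act x h) ` ?G = (\<lambda>x. act x h) ` T"
    by (metis finite_subset_image order_refl)
  \<comment> \<open>The translates of \<open>?H\<close> by the finitely many elements of
    \<open>T\<close> cover \<open>?G\<close>, so finiteness of the image passes from
    \<open>?H\<close> to \<open>?G\<close> and would put \<open>k\<close> into
    \<open>F\<close>.\<close>
  have "(\<lambda>x. act x (s k)) ` ?G
      \<subseteq> (\<lambda>(x, y). x + y) ` ((\<lambda>x. act x (s k)) ` T \<times> (\<lambda>x. act x (s k)) ` ?H)"
  proof (rule image_subsetI)
    fix x assume "x \<in> ?G"
    then obtain y where y: "y \<in> T" "act x h = act y h" using T by (metis (no_types, lifting) image_iff)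
    then have "x - y \<in> ?H"
      unfolding solutions_gcd_of[OF h] by (simp add: ann_def act_diff_left)
    moreover have "act x (s k) = act y (s k) + act (x - y) (s k)" by (simp add: act_diff_left)
    ultimately show "act x (s k) \<in> (\<lambda>(x, y). x + y) ` ((\<lambda>x. act x (s k)) ` T \<times> (\<lambda>x. act x (s k)) ` ?H)"
      using y by (intro image_eqI[of _ _ "(act y (s k), act (x - y) (s k))"]) auto
  qed
  then have "finite ((\<lambda>x. act x (s k)) ` ?G)"
    by (rule finite_subset) (use T k in simp)
  then show False using k F by blast
qed


text \<open>If no \<open>y\<close> works, the solutions of \<open>J\<close> in \<open>Y\<close> are
  covered by the other equations, already by those of finite index. Modulo the kernel of
  \<open>h\<close> this is a covering of finite sets, and inclusion-exclusion computes it from data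
  common to both modules. So the covering holds in \<open>X\<close> as well and makes
  \<open>x\<close> satisfy an equation outside its pattern.\<close>

lemma solution_pattern_transfer:
  assumes same: "same_invariants \<phi> X Y" and "finite S"
    and pattern: "\<And>J. J \<subseteq> S \<Longrightarrow> solutions X s b J = {} \<longleftrightarrow> solutions Y s b' J = {}"
  shows "\<exists>y. \<forall>k\<in>S. X x (s k) = b k \<longleftrightarrow> Y y (s k) = b' k"
proof (rule ccontr)
  assume neg: "\<not> ?thesis"
  have mods: "ring_endomorphism \<phi>" "right_module \<phi> X" "right_module \<phi> Y"
    using same by (auto simp: same_invariants_def nonzero_divisible_module_def)
  interpret X: right_module \<phi> X by (fact mods)
  interpret Y: right_module \<phi> Y by (fact mods)
  define J where "J = {k\<in>S. X x (s k) = b k}"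
  define F where "F = {k\<in>S - J. finite ((\<lambda>x. Y x (s k)) ` solutions Y s (\<lambda>_. 0) J)}"
  have sub: "J \<subseteq> S" "F \<subseteq> S" and "finite F" using \<open>finite S\<close> by (auto simp: J_def F_def)
  have x: "x \<in> solutions X s b J" by (simp add: J_def solutions_def)
  have covered: "\<exists>k\<in>S - J. Y y (s k) = b' k" if "y \<in> solutions Y s b' J" for y
  proof (rule ccontr)
    assume "\<not> ?thesis"
    then have "\<forall>k\<in>S. X x (s k) = b k \<longleftrightarrow> Y y (s k) = b' k"
      using that by (auto simp: J_def solutions_def)
    with neg show False by blast
  qed
  have covered': "\<exists>k\<in>F. Y y (s k) = b' k" if "y \<in> solutions Y s b' J" for y
    by (rule Y.covering_finite_index[OF mods(1) _ covered F_def that]) (use \<open>finite S\<close> in auto)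
  obtain h where h: "gcd_of \<phi> s (J \<union> F) h" by (rule gcd_of_exists[OF mods(1)])
  define A where "A k = (\<lambda>x. X x h) ` solutions X s b (insert k J)" for k
  define B where "B k = (\<lambda>x. Y x h) ` solutions Y s b' (insert k J)" for k
  define A0 where "A0 = (\<lambda>x. X x h) ` solutions X s b J"
  define B0 where "B0 = (\<lambda>x. Y x h) ` solutions Y s b' J"
  have ecard_eq: "ecard ((\<lambda>x. X x h) ` solutions X s b (J \<union> I))
      = ecard ((\<lambda>x. Y x h) ` solutions Y s b' (J \<union> I))" if "I \<subseteq> F" for I
  proof (cases "solutions X s b (J \<union> I) = {}")
    case True
    moreover from this have "solutions Y s b' (J \<union> I) = {}"
      using pattern[of "J \<union> I"] that sub by auto
    ultimately show ?thesis by (simp add: ecard_def)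
  next
    case False
    moreover from this have "solutions Y s b' (J \<union> I) \<noteq> {}"
      using pattern[of "J \<union> I"] that sub by auto
    ultimately show ?thesis
      using ecard_image_solutions_eq[OF same, of h s "J \<union> I"]
      by (simp add: X.ecard_image_solutions Y.ecard_image_solutions)
  qed
  have "finite ((\<lambda>x. Y x h) ` solutions Y s (\<lambda>_. 0) J)"
    by (rule Y.finite_image_gcd[OF h]) (simp add: F_def)
  moreover have "solutions Y s b' J \<noteq> {}" using x pattern[OF sub(1)] by auto
  ultimately have "finite B0"
    unfolding B0_def using Y.ecard_image_solutions ecard_eqD by metis
  \<comment> \<open>Finite index was imposed in \<open>Y\<close> only; equality of the cardinalities
    carries it over to \<open>X\<close>.\<close>
  then have "finite A0" and card0: "card A0 = card B0"
    using ecard_eqD[OF ecard_eq[of "{}"]] by (simp_all add: A0_def B0_def)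
  have A: "A k \<subseteq> A0" and B: "B k \<subseteq> B0" for k
    by (auto simp: A_def B_def A0_def B0_def solutions_def)
  have "card (\<Union>k\<in>F. A k) = card (\<Union>k\<in>F. B k)"
  proof (rule card_UN_eq_of_card_INT_eq[OF \<open>finite F\<close>])
    show "finite (A k)" "finite (B k)" for k
      using finite_subset[OF A \<open>finite A0\<close>] finite_subset[OF B \<open>finite B0\<close>] by simp_all
    show "card (\<Inter>k\<in>I. A k) = card (\<Inter>k\<in>I. B k)" if "I \<subseteq> F" "I \<noteq> {}" for I
      unfolding A_def B_def X.image_INT_solutions[OF h that] Y.image_INT_solutions[OF h that]
      using ecard_eqD[OF ecard_eq[OF that(1)]] by simp
  qed
  also have "(\<Union>k\<in>F. B k) = B0"
  proof (rule equalityI)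
    show "B0 \<subseteq> (\<Union>k\<in>F. B k)"
    proof
      fix w assume "w \<in> B0"
      then obtain y where y: "y \<in> solutions Y s b' J" "w = Y y h" by (auto simp: B0_def)
      from covered'[OF y(1)] obtain k where "k \<in> F" "Y y (s k) = b' k" by blast
      then show "w \<in> (\<Union>k\<in>F. B k)" using y by (auto simp: B_def solutions_def)
    qed
  qed (use B in blast)
  finally have "card (\<Union>k\<in>F. A k) = card A0" using card0 by simp
  then have "(\<Union>k\<in>F. A k) = A0" using A \<open>finite A0\<close> by (intro card_subset_eq) auto
  moreover have "X x h \<in> A0" using x by (auto simp: A0_def)
  ultimately obtain k z where k: "k \<in> F" "X x h = X z h" "z \<in> solutions X s b (insert k J)"
    by (auto simp: A_def)
  \<comment> \<open>Points with equal images under \<open>h\<close> satisfy the same equations of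
    \<open>F\<close>.\<close>
  then have "x - z \<in> solutions X s (\<lambda>_. 0) (J \<union> F)"
    unfolding X.solutions_gcd_of[OF h] by (simp add: ann_def X.act_diff_left)
  then have "X x (s k) = b k" using k by (simp add: solutions_def X.act_diff_left)
  then show False using k(1) by (auto simp: F_def J_def)
qed


section \<open>Elimination of a quantifier\<close>

primrec var_coeff :: "('k::field \<Rightarrow> 'k) \<Rightarrow> nat \<Rightarrow> 'k poly tm \<Rightarrow> 'k poly" where
  "var_coeff \<phi> n (Var m) = (if m = n then 1 else 0)"
| "var_coeff \<phi> n Zero = 0"
| "var_coeff \<phi> n (Plus a b) = var_coeff \<phi> n a + var_coeff \<phi> n b"
| "var_coeff \<phi> n (Minus a) = - var_coeff \<phi> n a"
| "var_coeff \<phi> n (Act a r) = skew_mult \<phi> (var_coeff \<phi> n a) r"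

primrec drop_var :: "nat \<Rightarrow> 'r tm \<Rightarrow> 'r tm" where
  "drop_var n (Var m) = (if m = n then Zero else Var m)"
| "drop_var n Zero = Zero"
| "drop_var n (Plus a b) = Plus (drop_var n a) (drop_var n b)"
| "drop_var n (Minus a) = Minus (drop_var n a)"
| "drop_var n (Act a r) = Act (drop_var n a) r"

lemma fv_drop_var: "fv_tm (drop_var n a) = fv_tm a - {n}"
  by (induction a) auto

lemma (in right_module) eval_fun_upd:
  "eval_tm act (e(n := y)) a = act y (var_coeff \<phi> n a) + eval_tm act e (drop_var n a)"
  by (induction a)
    (auto simp: act_one act_zero_right act_add_right act_add_left act_minus_right act_mult)

primrec is_equation :: "'r fm \<Rightarrow> bool" where
  "is_equation (Eq a b) = True"
| "is_equation (Neg F) = False"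
| "is_equation (Conj F G) = False"
| "is_equation (Exists n F) = False"

text \<open>The equation \<open>F\<close>, solved for the \<open>n\<close>-th variable \<open>y\<close>, reads \<open>y s = b\<close>, where
  \<open>linear_eq \<phi> n F = (s, b)\<close>.\<close>

definition linear_eq :: "('k::field \<Rightarrow> 'k) \<Rightarrow> nat \<Rightarrow> 'k poly fm \<Rightarrow> 'k poly \<times> 'k poly tm" where
  "linear_eq \<phi> n F = (case F of
     Eq a b \<Rightarrow> (var_coeff \<phi> n a - var_coeff \<phi> n b, Plus (drop_var n b) (Minus (drop_var n a)))
   | _ \<Rightarrow> (0, Zero))"

lemma (in right_module) sat_linear_eq:
  assumes "is_equation F"
  shows "sat act (e(n := y)) F \<longleftrightarrow>
    act y (fst (linear_eq \<phi> n F)) = eval_tm act e (snd (linear_eq \<phi> n F))"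
proof (cases F)
  case (Eq a b)
  then show ?thesis
    by (auto simp: linear_eq_def eval_fun_upd act_diff_right algebra_simps)
qed (use assms in simp_all)

lemma fv_linear_eq: "fv_tm (snd (linear_eq \<phi> n F)) \<subseteq> fv F - {n}"
  by (cases F) (auto simp: linear_eq_def fv_drop_var)

text \<open>Compatibility conditions for a system summed up by \<open>y g = t\<close>: an equation
  \<open>y s = b\<close> with \<open>s = g u\<close> demands \<open>t u = b\<close>. The choices by
  \<open>SOME\<close> involve only \<phi> and \<open>E\<close>, so all modules receive the same
  formulas.\<close>

definition solvability :: "('k::field \<Rightarrow> 'k) \<Rightarrow> ('k poly \<times> 'k poly tm) set \<Rightarrow> 'k poly fm set" where
  "solvability \<phi> E = (let d = SOME d. generates \<phi> E d in
     (\<lambda>e. Eq (Act (snd d) (SOME u. fst e = skew_mult \<phi> (fst d) u)) (snd e)) ` E)"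

lemma solvability_eq_equations:
  assumes "ring_endomorphism \<phi>"
  obtains g t u where "generates \<phi> E (g, t)" "\<forall>e\<in>E. fst e = skew_mult \<phi> g (u e)"
    and "solvability \<phi> E = (\<lambda>e. Eq (Act t (u e)) (snd e)) ` E"
proof -
  define d where "d = (SOME d. generates \<phi> E d)"
  have d: "generates \<phi> E (fst d, snd d)"
    using someI_ex[OF generates_exists[OF assms]] by (simp add: d_def)
  show thesis
  proof (rule that[OF d])
    show "\<forall>e\<in>E. fst e = skew_mult \<phi> (fst d) (SOME u. fst e = skew_mult \<phi> (fst d) u)"
    proof
      fix e assume "e \<in> E"
      then have "\<exists>u. fst e = skew_mult \<phi> (fst d) u" using d by (simp add: generates_def)
      then show "fst e = skew_mult \<phi> (fst d) (SOME u. fst e = skew_mult \<phi> (fst d) u)"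
        by (rule someI_ex)
    qed
  qed (simp add: solvability_def d_def Let_def)
qed

text \<open>A solution of \<open>E\<close> satisfies the consequence \<open>y g = t\<close>, hence
  \<open>b = y s = y g u = t u\<close>. Conversely, \<open>y g = t\<close> has a solution, by
  divisibility or because \<open>t\<close> is \<open>Zero\<close> when \<open>g = 0\<close>, and
  under the conditions it solves \<open>E\<close>.\<close>

lemma sat_solvability:
  assumes "ring_endomorphism \<phi>" "nonzero_divisible_module \<phi> X"
  shows "(\<forall>F\<in>solvability \<phi> E. sat X e F) \<longleftrightarrow> (\<exists>y. \<forall>d\<in>E. X y (fst d) = eval_tm X e (snd d))"
proof -
  interpret right_module \<phi> X using assms(2) by (simp add: nonzero_divisible_module_def)
  obtain g t u where gen: "generates \<phi> E (g, t)"
    and u: "\<forall>d\<in>E. fst d = skew_mult \<phi> g (u d)"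
    and eqs: "solvability \<phi> E = (\<lambda>e. Eq (Act t (u e)) (snd e)) ` E"
    by (rule solvability_eq_equations[OF assms(1), where E = E])
  have "\<exists>y. X y g = eval_tm X e t"
  proof (cases "g = 0")
    case True
    then show ?thesis using gen by (auto simp: generates_def act_zero_right)
  next
    case False
    then show ?thesis
      using assms(2) by (simp add: nonzero_divisible_module_def divisible_module_def)
  qed
  then obtain y0 where y0: "X y0 g = eval_tm X e t" by blast
  have "X y g = eval_tm X e t" if "\<forall>d\<in>E. X y (fst d) = eval_tm X e (snd d)" for y
    by (rule eval_consequences[of g t E]) (use gen that in \<open>auto simp: generates_def\<close>)
  then show ?thesis
    unfolding eqs using y0 u by (auto simp: act_mult intro!: exI[of _ y0])
qed

lemma finite_solvability: "finite E \<Longrightarrow> finite (solvability \<phi> E)"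
  by (simp add: solvability_def Let_def)

lemma is_equation_solvability: "F \<in> solvability \<phi> E \<Longrightarrow> is_equation F"
  by (auto simp: solvability_def Let_def)

lemma fv_solvability:
  assumes "ring_endomorphism \<phi>" "F \<in> solvability \<phi> E"
  shows "fv F \<subseteq> (\<Union>e\<in>E. fv_tm (snd e))"
proof -
  obtain g t u where gen: "generates \<phi> E (g, t)"
    and eqs: "solvability \<phi> E = (\<lambda>e. Eq (Act t (u e)) (snd e)) ` E"
    by (rule solvability_eq_equations[OF assms(1), where E = E])
  from gen have "fv_tm t \<subseteq> (\<Union>e\<in>E. fv_tm (snd e))"
    using fv_consequences[of "(g, t)" \<phi> E] by (simp add: generates_def)
  moreover obtain e where "e \<in> E" "fv F = fv_tm t \<union> fv_tm (snd e)"
    using assms(2) unfolding eqs by auto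
  ultimately show ?thesis by blast
qed

text \<open>Finitely many equations whose truth values determine that of \<open>F\<close>. They depend on \<open>F\<close> alone,
  so that two modules on different types can be compared.\<close>

primrec atoms :: "('k::field \<Rightarrow> 'k) \<Rightarrow> 'k poly fm \<Rightarrow> 'k poly fm set" where
  "atoms \<phi> (Eq a b) = {Eq a b}"
| "atoms \<phi> (Neg F) = atoms \<phi> F"
| "atoms \<phi> (Conj F G) = atoms \<phi> F \<union> atoms \<phi> G"
| "atoms \<phi> (Exists n F) = (\<Union>J\<in>Pow (atoms \<phi> F). solvability \<phi> (linear_eq \<phi> n ` J))"

lemma finite_atoms: "finite (atoms \<phi> F)"
proof (induction F)
  case (Exists n F)
  have "finite (solvability \<phi> (linear_eq \<phi> n ` J))" if "J \<in> Pow (atoms \<phi> F)" for J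
    using that Exists finite_subset by (intro finite_solvability finite_imageI) blast
  with Exists show ?case by simp
qed simp_all

lemma is_equation_atoms: "a \<in> atoms \<phi> F \<Longrightarrow> is_equation a"
  by (induction F) (auto dest: is_equation_solvability)

lemma fv_atoms:
  assumes "ring_endomorphism \<phi>"
  shows "a \<in> atoms \<phi> F \<Longrightarrow> fv a \<subseteq> fv F"
proof (induction F arbitrary: a)
  case (Exists n F)
  then obtain J where J: "J \<subseteq> atoms \<phi> F" "a \<in> solvability \<phi> (linear_eq \<phi> n ` J)" by auto
  have "fv a \<subseteq> (\<Union>c\<in>J. fv_tm (snd (linear_eq \<phi> n c)))"
    using fv_solvability[OF assms J(2)] by simp
  moreover have "fv_tm (snd (linear_eq \<phi> n c)) \<subseteq> fv F - {n}" if "c \<in> J" for c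
    using fv_linear_eq[of \<phi> n c] Exists.IH[of c] J(1) that by blast
  ultimately show ?case by (simp add: subset_iff) blast
qed auto

text \<open>One back-and-forth step: agreement on the solvability conditions says that the same
  subsystems are solvable in both modules, which is what \<open>solution_pattern_transfer\<close>
  asks for.\<close>

lemma exists_transfer:
  assumes same: "same_invariants \<phi> X Y"
    and S: "finite S" "\<And>a. a \<in> S \<Longrightarrow> is_equation a"
    and agree: "\<forall>a\<in>(\<Union>J\<in>Pow S. solvability \<phi> (linear_eq \<phi> n ` J)). sat X e a = sat Y e' a"
  shows "\<exists>y. \<forall>a\<in>S. sat X (e(n := x)) a = sat Y (e'(n := y)) a"
proof -
  have mods: "ring_endomorphism \<phi>" "nonzero_divisible_module \<phi> X" "nonzero_divisible_module \<phi> Y"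
    using same by (auto simp: same_invariants_def)
  interpret X: right_module \<phi> X using mods by (simp add: nonzero_divisible_module_def)
  interpret Y: right_module \<phi> Y using mods by (simp add: nonzero_divisible_module_def)
  let ?s = "\<lambda>a. fst (linear_eq \<phi> n a)"
  let ?b = "\<lambda>a. eval_tm X e (snd (linear_eq \<phi> n a))"
  let ?b' = "\<lambda>a. eval_tm Y e' (snd (linear_eq \<phi> n a))"
  have "\<exists>y. \<forall>a\<in>S. X x (?s a) = ?b a \<longleftrightarrow> Y y (?s a) = ?b' a"
  proof (rule solution_pattern_transfer[OF same S(1)])
    fix J assume J: "J \<subseteq> S"
    have "solutions X ?s ?b J \<noteq> {} \<longleftrightarrow> (\<forall>F\<in>solvability \<phi> (linear_eq \<phi> n ` J). sat X e F)"
      unfolding sat_solvability[OF mods(1,2)] by (auto simp: solutions_def)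
    also have "\<dots> \<longleftrightarrow> (\<forall>F\<in>solvability \<phi> (linear_eq \<phi> n ` J). sat Y e' F)"
      using agree J by (intro ball_cong) auto
    also have "\<dots> \<longleftrightarrow> solutions Y ?s ?b' J \<noteq> {}"
      unfolding sat_solvability[OF mods(1,3)] by (auto simp: solutions_def)
    finally show "solutions X ?s ?b J = {} \<longleftrightarrow> solutions Y ?s ?b' J = {}" by blast
  qed
  then show ?thesis using S(2) by (simp add: X.sat_linear_eq Y.sat_linear_eq)
qed

text \<open>A back-and-forth induction. The atoms of \<open>Exists n F\<close> are those needed to
  answer a witness in one module by a witness in the other; the converse direction uses the symmetry
  of \<open>same_invariants\<close>.\<close>

lemma sat_transfer:
  assumes same: "same_invariants \<phi> X Y"
  shows "\<forall>a\<in>atoms \<phi> F. sat X e a = sat Y e' a \<Longrightarrow> sat X e F = sat Y e' F"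
proof (induction F arbitrary: e e')
  case (Exists n F)
  note S = finite_atoms[of \<phi> F] is_equation_atoms[of _ \<phi> F]
  show ?case
  proof
    assume "sat X e (Exists n F)"
    then obtain x where x: "sat X (e(n := x)) F" by auto
    obtain y where "\<forall>a\<in>atoms \<phi> F. sat X (e(n := x)) a = sat Y (e'(n := y)) a"
      using exists_transfer[OF same S, of n e e' x] Exists.prems by auto
    from Exists.IH[OF this] x show "sat Y e' (Exists n F)" unfolding sat.simps by blast
  next
    assume "sat Y e' (Exists n F)"
    then obtain y where y: "sat Y (e'(n := y)) F" by auto
    obtain x where "\<forall>a\<in>atoms \<phi> F. sat Y (e'(n := y)) a = sat X (e(n := x)) a"
      using exists_transfer[OF same_invariants_sym[OF same] S, of n e' e y] Exists.prems by auto
    then have "\<forall>a\<in>atoms \<phi> F. sat X (e(n := x)) a = sat Y (e'(n := y)) a" by simp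
    from Exists.IH[OF this] y show "sat X e (Exists n F)" unfolding sat.simps by blast
  qed
next
  case (Neg F)
  then show ?case using Neg.IH[of e e'] by simp
next
  case (Conj F G)
  then have "sat X e F = sat Y e' F" "sat X e G = sat Y e' G" by (simp_all add: ball_Un)
  then show ?case by simp
qed simp


section \<open>Formulas and theories\<close>

definition conjs :: "'r fm list \<Rightarrow> 'r fm" where
  "conjs Fs = foldr Conj Fs (Eq Zero Zero)"

lemma sat_conjs: "sat act e (conjs Fs) \<longleftrightarrow> (\<forall>F\<in>set Fs. sat act e F)"
  unfolding conjs_def by (induction Fs) auto

lemma quantifier_free_conjs: "quantifier_free (conjs Fs) \<longleftrightarrow> (\<forall>F\<in>set Fs. quantifier_free F)"
  unfolding conjs_def by (induction Fs) auto

lemma fv_conjs: "fv (conjs Fs) = (\<Union>F\<in>set Fs. fv F)"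
  unfolding conjs_def by (induction Fs) auto

text \<open>Disjunctive normal form: \<open>G\<close> is the disjunction of those truth patterns on
  \<open>S\<close> that some assignment satisfying \<open>F\<close> realises.\<close>

lemma quantifier_free_equivalent:
  assumes "finite S" "\<And>a. a \<in> S \<Longrightarrow> quantifier_free a"
    and agree: "\<And>e e'. \<forall>a\<in>S. sat act e a = sat act e' a \<Longrightarrow> sat act e F = sat act e' F"
  obtains G where "quantifier_free G" "fv G \<subseteq> (\<Union>a\<in>S. fv a)" "\<And>e. sat act e G = sat act e F"
proof -
  obtain as where as: "set as = S" using finite_list[OF assms(1)] by blast
  define \<Gamma> where "\<Gamma> P = conjs (map (\<lambda>a. if a \<in> P then a else Neg a) as)" for P
  let ?P = "\<lambda>e. {a\<in>S. sat act e a}"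
  have "finite {?P e |e. sat act e F}"
    by (rule finite_subset[of _ "Pow S"]) (use assms(1) in auto)
  from finite_list[OF this] obtain Ps where Ps: "set Ps = {?P e |e. sat act e F}" by blast
  have \<Gamma>: "sat act e' (\<Gamma> (?P e)) \<longleftrightarrow> (\<forall>a\<in>S. sat act e a = sat act e' a)" for e e'
  proof -
    have "sat act e' (if a \<in> ?P e then a else Neg a) \<longleftrightarrow> sat act e a = sat act e' a" if "a \<in> S" for a
      using that by simp
    then show ?thesis unfolding \<Gamma>_def sat_conjs set_map as by blast
  qed
  show thesis
  proof (rule that[of "Neg (conjs (map (\<lambda>P. Neg (\<Gamma> P)) Ps))"])
    show "quantifier_free (Neg (conjs (map (\<lambda>P. Neg (\<Gamma> P)) Ps)))"
      using assms(2) by (auto simp: quantifier_free_conjs \<Gamma>_def as)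
    show "fv (Neg (conjs (map (\<lambda>P. Neg (\<Gamma> P)) Ps))) \<subseteq> (\<Union>a\<in>S. fv a)"
      by (auto simp: fv_conjs \<Gamma>_def as split: if_splits)
    fix e'
    have "sat act e' (Neg (conjs (map (\<lambda>P. Neg (\<Gamma> P)) Ps)))
        \<longleftrightarrow> (\<exists>e. sat act e F \<and> sat act e' (\<Gamma> (?P e)))"
      by (auto simp: sat_conjs Ps)
    also have "\<dots> \<longleftrightarrow> sat act e' F" unfolding \<Gamma> using agree by blast
    finally show "sat act e' (Neg (conjs (map (\<lambda>P. Neg (\<Gamma> P)) Ps))) = sat act e' F" .
  qed
qed

section \<open>Sentences, theories and quantifier elimination\<close>

lemma eval_tm_cong: "(\<And>n. n \<in> fv_tm a \<Longrightarrow> e n = e' n) \<Longrightarrow> eval_tm act e a = eval_tm act e' a"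
  by (induction a) auto

lemma sat_cong: "(\<And>n. n \<in> fv F \<Longrightarrow> e n = e' n) \<Longrightarrow> sat act e F = sat act e' F"
proof (induction F arbitrary: e e')
  case (Eq a b)
  then have "eval_tm act e a = eval_tm act e' a" "eval_tm act e b = eval_tm act e' b"
    by (auto intro: eval_tm_cong)
  then show ?case by simp
next
  case (Neg F)
  have "sat act e F = sat act e' F" by (rule Neg.IH) (use Neg.prems in auto)
  then show ?case by simp
next
  case (Conj F G)
  have "sat act e F = sat act e' F" by (rule Conj.IH(1)) (use Conj.prems in auto)
  moreover have "sat act e G = sat act e' G" by (rule Conj.IH(2)) (use Conj.prems in auto)
  ultimately show ?case by simp
next
  case (Exists n F)
  have "sat act (e(n := x)) F = sat act (e'(n := x)) F" for x
    by (rule Exists.IH) (use Exists.prems in auto)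
  then show ?case by simp
qed

lemma Th_iff_sat: "sentence F \<Longrightarrow> F \<in> Th act \<longleftrightarrow> sat act e F"
  unfolding Th_def sentence_def using sat_cong[of F] by blast

lemma finite_fv_tm: "finite (fv_tm a)"
  by (induction a) auto

lemma finite_fv: "finite (fv F)"
  by (induction F) (auto simp: finite_fv_tm)

lemma univ_closure_in_Th:
  assumes "\<And>e. sat act e F"
  shows "univ_closure F \<in> Th act"
proof -
  have "fv (foldr Forall ns F) = fv F - set ns" for ns
    by (induction ns) (auto simp: Forall_def)
  then have "sentence (univ_closure F)"
    by (simp add: sentence_def univ_closure_def finite_fv)
  moreover have "\<forall>e. sat act e (foldr Forall ns F)" for ns
    by (induction ns) (auto simp: Forall_def assms)
  ultimately show ?thesis by (simp add: Th_def univ_closure_def)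
qed

text \<open>\<open>sat_transfer\<close> compares \<open>X\<close> with itself under two assignments,
  so the atoms of a formula decide its truth.\<close>

lemma admits_qe_Th:
  assumes "ring_endomorphism \<phi>" "nonzero_divisible_module \<phi> X"
  shows "admits_qe (Th X)"
  unfolding admits_qe_def
proof
  fix F
  have same: "same_invariants \<phi> X X" using assms by (simp add: same_invariants_def)
  have "quantifier_free a" if "a \<in> atoms \<phi> F" for a
    using is_equation_atoms[OF that] by (cases a) auto
  then obtain G where G: "quantifier_free G" "fv G \<subseteq> (\<Union>a\<in>atoms \<phi> F. fv a)"
    "\<And>e. sat X e G = sat X e F"
    using quantifier_free_equivalent[OF finite_atoms _ sat_transfer[OF same]] by metis
  moreover have "fv G \<subseteq> fv F" using G(2) fv_atoms[OF assms(1)] by blast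
  moreover have "univ_closure (Iff F G) \<in> Th X"
    by (rule univ_closure_in_Th) (simp add: Iff_def G)
  ultimately show "\<exists>G. quantifier_free G \<and> fv G \<subseteq> fv F \<and> univ_closure (Iff F G) \<in> Th X" by blast
qed

lemma (in right_module) eval_closed_tm: "fv_tm a = {} \<Longrightarrow> eval_tm act e a = 0"
  by (induction a) (auto simp: act_zero_left)

text \<open>The atoms of a sentence are closed equations; closed terms denote 0, so these atoms are
  true in both modules.\<close>

lemma Th_eq:
  assumes same: "same_invariants \<phi> X Y"
  shows "Th X = Th Y"
proof -
  have mods: "ring_endomorphism \<phi>" "right_module \<phi> X" "right_module \<phi> Y"
    using same by (auto simp: same_invariants_def nonzero_divisible_module_def)
  interpret X: right_module \<phi> X by (fact mods)
  interpret Y: right_module \<phi> Y by (fact mods)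
  have "F \<in> Th X \<longleftrightarrow> F \<in> Th Y" if F: "sentence F" for F
  proof -
    have "sat X (\<lambda>_. 0) a = sat Y (\<lambda>_. 0) a" if a: "a \<in> atoms \<phi> F" for a
    proof -
      have "fv a = {}" using fv_atoms[OF mods(1) a] F by (simp add: sentence_def)
      moreover obtain s t where "a = Eq s t" using is_equation_atoms[OF a] by (cases a) auto
      ultimately show ?thesis by (simp add: X.eval_closed_tm Y.eval_closed_tm)
    qed
    then have "sat X (\<lambda>_. 0) F = sat Y (\<lambda>_. 0) F" by (intro sat_transfer[OF same]) blast
    then show ?thesis
      by (simp add: Th_iff_sat[OF F, where e = "\<lambda>_. 0"])
  qed
  then show ?thesis by (auto simp: Th_def)
qed

section \<open>Counting annihilators by first-order sentences\<close>

lemma sat_foldr_Exists: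
  "sat act e (foldr Exists ns F) \<longleftrightarrow> (\<exists>e'. (\<forall>i. i \<notin> set ns \<longrightarrow> e' i = e i) \<and> sat act e' F)"
proof (induction ns arbitrary: e)
  case Nil
  have "e' = e" if "\<forall>i. e' i = e i" for e' using that by auto
  then show ?case by auto
next
  case (Cons n ns)
  have "(\<exists>x. \<forall>i. i \<notin> set ns \<longrightarrow> e' i = (e(n := x)) i)
      \<longleftrightarrow> (\<forall>i. i \<notin> set (n # ns) \<longrightarrow> e' i = e i)" for e'
    by (auto intro: exI[of _ "e' n"])
  then show ?case by (simp add: Cons.IH) blast
qed

definition at_least :: "nat \<Rightarrow> 'r \<Rightarrow> 'r fm" where
  "at_least n q = foldr Exists [0..<n]
     (conjs (map (\<lambda>i. Conj (Eq (Act (Var i) q) Zero)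
       (conjs (map (\<lambda>j. Neg (Eq (Var i) (Var j))) [0..<i]))) [0..<n]))"

lemma fv_foldr_Exists: "fv (foldr Exists ns F) = fv F - set ns"
  by (induction ns) auto

lemma sentence_at_least: "sentence (at_least n q)"
  by (auto simp: sentence_def at_least_def fv_foldr_Exists fv_conjs)

lemma inj_on_lessThan_iff: "inj_on f {..<n} \<longleftrightarrow> (\<forall>i<n. \<forall>j<i. f i \<noteq> f j)" for n :: nat
proof
  assume *: "\<forall>i<n. \<forall>j<i. f i \<noteq> f j"
  show "inj_on f {..<n}"
  proof (rule inj_onI)
    fix i j assume "i \<in> {..<n}" "j \<in> {..<n}" "f i = f j"
    then show "i = j" using * by (cases i j rule: linorder_cases) force+
  qed
qed (force simp: inj_on_def)

lemma sat_at_least: "sat act e (at_least n q) \<longleftrightarrow> enat n \<le> ecard (ann act q)"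
proof -
  let ?A = "ann act q"
  have "sat act e (at_least n q) \<longleftrightarrow> (\<exists>e'. (\<forall>i. i \<notin> {..<n} \<longrightarrow> e' i = e i) \<and>
      e' ` {..<n} \<subseteq> ?A \<and> inj_on e' {..<n})"
    unfolding at_least_def sat_foldr_Exists sat_conjs inj_on_lessThan_iff
    by (intro ex_cong1) (auto simp: ann_def sat_conjs image_subset_iff)
  also have "\<dots> \<longleftrightarrow> (\<exists>f. f ` {..<n} \<subseteq> ?A \<and> inj_on f {..<n})"
  proof
    assume "\<exists>f. f ` {..<n} \<subseteq> ?A \<and> inj_on f {..<n}"
    then obtain f where f: "f ` {..<n} \<subseteq> ?A" "inj_on f {..<n}" by blast
    let ?f = "\<lambda>i. if i < n then f i else e i"
    have "?f ` {..<n} \<subseteq> ?A" using f(1) by auto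
    moreover have "inj_on ?f {..<n}" using f(2) by (auto simp: inj_on_def)
    ultimately show "\<exists>e'. (\<forall>i. i \<notin> {..<n} \<longrightarrow> e' i = e i) \<and> e' ` {..<n} \<subseteq> ?A \<and> inj_on e' {..<n}"
      by (intro exI[of _ ?f]) auto
  qed blast
  also have "\<dots> \<longleftrightarrow> enat n \<le> ecard ?A"
  proof (cases "finite ?A")
    case True
    then show ?thesis
      using card_le_inj[of "{..<n}" ?A] card_inj_on_le[of _ "{..<n}" ?A] by (auto simp: ecard_def)
  next
    case False
    then obtain B where B: "finite B" "card B = n" "B \<subseteq> ?A"
      by (metis infinite_arbitrarily_large)
    then have "\<exists>f. f ` {..<n} \<subseteq> ?A \<and> inj_on f {..<n}"
      using card_le_inj[of "{..<n}" B] by auto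
    then show ?thesis using False by (simp add: ecard_def)
  qed
  finally show ?thesis .
qed

text \<open>Infinity, too, is determined by the naturals below it. The sentences
  \<open>at_least\<close> therefore fix the invariant even though each of them only gives a finite
  bound.\<close>

lemma enat_eqI:
  fixes a b :: enat
  assumes "\<And>n. enat n \<le> a \<longleftrightarrow> enat n \<le> b"
  shows "a = b"
proof -
  have "a \<le> b" if *: "\<And>n. enat n \<le> a \<Longrightarrow> enat n \<le> b" for a b :: enat
  proof (cases b)
    case (enat k)
    then have "\<not> enat (Suc k) \<le> a" using *[of "Suc k"] by auto
    then show ?thesis using * by (cases a) auto
  qed simp
  then show ?thesis using assms by (intro antisym) blast+
qed

lemma ecard_ann_eq_of_Th_eq:
  assumes "Th X = Th Y"
  shows "ecard (ann X q) = ecard (ann Y q)"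
proof (rule enat_eqI)
  fix n
  have "enat n \<le> ecard (ann X q) \<longleftrightarrow> at_least n q \<in> Th X"
    by (simp add: Th_iff_sat[OF sentence_at_least, where e = "\<lambda>_. 0"] sat_at_least)
  also have "\<dots> \<longleftrightarrow> enat n \<le> ecard (ann Y q)"
    by (simp add: assms Th_iff_sat[OF sentence_at_least, where e = "\<lambda>_. 0"] sat_at_least)
  finally show "enat n \<le> ecard (ann X q) \<longleftrightarrow> enat n \<le> ecard (ann Y q)" .
qed

theorem mainTheorem1:
  fixes \<phi> :: "'k::field \<Rightarrow> 'k"
    and M :: "'m::ab_group_add \<Rightarrow> 'k poly \<Rightarrow> 'm"
    and N :: "'n::ab_group_add \<Rightarrow> 'k poly \<Rightarrow> 'n"
  assumes "ring_endomorphism \<phi>"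
    and "nonzero_divisible_module \<phi> M"
    and "nonzero_divisible_module \<phi> N"
  shows "(\<forall>T. complete_theory T \<and> is_model M T \<longrightarrow> admits_qe T) \<and>
         (elementarily_equivalent M N \<longleftrightarrow>
            (\<forall>q. skew_irreducible \<phi> q \<longrightarrow> ecard (ann M q) = ecard (ann N q)))"
proof (intro conjI allI impI)
  fix T assume "complete_theory T \<and> is_model M T"
  \<comment> \<open>A complete theory with model \<open>M\<close> coincides with
    \<open>Th M\<close>.\<close>
  then show "admits_qe T"
    using complete_theory_eq_Th admits_qe_Th[OF assms(1,2)] by metis
next
  show "elementarily_equivalent M N \<longleftrightarrow>
      (\<forall>q. skew_irreducible \<phi> q \<longrightarrow> ecard (ann M q) = ecard (ann N q))"
    unfolding elementarily_equivalent_def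
  proof
    assume "Th M = Th N"
    from ecard_ann_eq_of_Th_eq[OF this]
    show "\<forall>q. skew_irreducible \<phi> q \<longrightarrow> ecard (ann M q) = ecard (ann N q)" by blast
  next
    assume irr: "\<forall>q. skew_irreducible \<phi> q \<longrightarrow> ecard (ann M q) = ecard (ann N q)"
    have "same_invariants \<phi> M N"
      by (rule same_invariants_irreducible[OF assms]) (rule irr[rule_format])
    then show "Th M = Th N" by (rule Th_eq)
  qed
qed

end
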